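(* Let $G$ be a group and let $H$ be a normal subgroup of $G$ such that both the subgroup $H$ and the quotient group $G/H$ are groups of finite $C$-width. Then $G$ is also a group of finite $C$-width.
   Context: For a group $G$ and a generating set $S$ of $G$, the length $|g|_S$ of $g\in G$ is the least number of elements of $S\cup S^{-1}$ whose product is $g$; the width of $G$ relative to $S$ is $\mathrm{wid}(G,S)=\sup\{|g|_S: g\in G\}$. A generating set $S$ of $G$ is conjugation-invariant if $gSg^{-1}=S$ for all $g\in G$. The group $G$ is a group of finite $C$-width if $\mathrm{wid}(G,S)<\infty$ for every conjugation-invariant generating set $S$ of $G$. *)

theory Defs
  imports "HOL-Algebra.Algebra" "HOL-Library.Extended_Nat"
begin

definition generating_set :: "('a, 'b) monoid_scheme \<Rightarrow> 'a set \<Rightarrow> bool" where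
  "generating_set G S \<longleftrightarrow> S \<subseteq> carrier G \<and> generate G S = carrier G"

text \<open>
  The length is the infimum in \<^typ>\<open>enat\<close>: it is the least length of a word in
  \<open>S \<union> S\<^sup>-\<^sup>1\<close> representing \<open>g\<close> (the empty word has product \<open>\<one>\<close>, so \<open>\<one>\<close> has length 0),
  and it is \<open>\<infinity>\<close> if there is no such word, which cannot happen if \<open>S\<close> generates \<open>G\<close>.
\<close>

definition word_length :: "('a, 'b) monoid_scheme \<Rightarrow> 'a set \<Rightarrow> 'a \<Rightarrow> enat" where
  "word_length G S g =
     Inf {enat (length ws) | ws. set ws \<subseteq> S \<union> set_inv\<^bsub>G\<^esub> S \<and> foldr (\<otimes>\<^bsub>G\<^esub>) ws \<one>\<^bsub>G\<^esub> = g}"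

definition width :: "('a, 'b) monoid_scheme \<Rightarrow> 'a set \<Rightarrow> enat" where
  "width G S = (SUP g\<in>carrier G. word_length G S g)"

definition conjugation_invariant :: "('a, 'b) monoid_scheme \<Rightarrow> 'a set \<Rightarrow> bool" where
  "conjugation_invariant G S \<longleftrightarrow> (\<forall>g\<in>carrier G. (g <#\<^bsub>G\<^esub> S) #>\<^bsub>G\<^esub> inv\<^bsub>G\<^esub> g = S)"

definition finite_C_width :: "('a, 'b) monoid_scheme \<Rightarrow> bool" where
  "finite_C_width G \<longleftrightarrow>
     (\<forall>S. generating_set G S \<and> conjugation_invariant G S \<longrightarrow> width G S < \<infinity>)"

end

theory Submission
  imports Defs
begin

text \<open>
  Let \<open>S\<close> be a conjugation-invariant generating set of \<open>G\<close>, and write \<open>B n\<close> for the set of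
  products of at most \<open>n\<close> letters from \<open>S \<union> S\<^sup>-\<^sup>1\<close>. Finite width means that some \<open>B n\<close> is the
  whole group (\<open>finite_width_iff\<close>).

  The image of \<open>S\<close> in \<open>G/H\<close> is a conjugation-invariant generating set, so there is an \<open>n\<close> with
  \<open>G = B n \<cdot> H\<close>. The set \<open>S\<close> itself may well miss \<open>H\<close>, but its short products do not: put
  \<open>T = H \<inter> B (2n + 1)\<close>. This set is conjugation-invariant because \<open>H\<close> is normal and \<open>S\<close> is
  conjugation-invariant. It generates \<open>H\<close> by a Schreier-type argument (\<open>Schreier_short_generators\<close>):
  the representatives of the cosets of \<open>H\<close> can be taken in \<open>B n\<close>, so the Schreier generators,
  which are products of a representative, a letter and an inverse of a representative, lie in
  \<open>B (n + 1 + n)\<close>. Hence every element of \<open>H\<close> is a product of at most some fixed number \<open>k\<close> of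
  elements of \<open>T \<union> T\<^sup>-\<^sup>1\<close>, so \<open>H \<subseteq> B (k (2n + 1))\<close> and \<open>G = B n \<cdot> H \<subseteq> B (n + k (2n + 1))\<close>.
\<close>

section \<open>Word balls and finite width\<close>

definition word_ball :: "('a, 'b) monoid_scheme \<Rightarrow> 'a set \<Rightarrow> nat \<Rightarrow> 'a set" where
  "word_ball G S n =
     {foldr (\<otimes>\<^bsub>G\<^esub>) ws \<one>\<^bsub>G\<^esub> | ws. set ws \<subseteq> S \<union> set_inv\<^bsub>G\<^esub> S \<and> length ws \<le> n}"

lemma word_length_le_iff: "word_length G S g \<le> enat n \<longleftrightarrow> g \<in> word_ball G S n"
proof
  let ?L = "{enat (length ws) | ws. set ws \<subseteq> S \<union> set_inv\<^bsub>G\<^esub> S \<and> foldr (\<otimes>\<^bsub>G\<^esub>) ws \<one>\<^bsub>G\<^esub> = g}"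
  assume le: "word_length G S g \<le> enat n"
  then have "?L \<noteq> {}"
    unfolding word_length_def by (metis (lifting) Inf_enat_def enat_ord_code(5))
  then have "Inf ?L \<in> ?L"
    unfolding Inf_enat_def by (metis (lifting) LeastI ex_in_conv)
  with le show "g \<in> word_ball G S n"
    unfolding word_length_def word_ball_def by fastforce
next
  assume "g \<in> word_ball G S n"
  then obtain ws where "set ws \<subseteq> S \<union> set_inv\<^bsub>G\<^esub> S" "length ws \<le> n"
    "foldr (\<otimes>\<^bsub>G\<^esub>) ws \<one>\<^bsub>G\<^esub> = g"
    unfolding word_ball_def by auto
  then show "word_length G S g \<le> enat n"
    unfolding word_length_def by (intro Inf_lower2[of "enat (length ws)"]) auto
qed

lemma finite_width_iff: "width G S < \<infinity> \<longleftrightarrow> (\<exists>n. carrier G \<subseteq> word_ball G S n)"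
proof -
  have "width G S < \<infinity> \<longleftrightarrow> (\<exists>n. width G S \<le> enat n)"
    by (cases "width G S") auto
  then show ?thesis
    by (auto simp: width_def SUP_le_iff word_length_le_iff subset_iff)
qed

lemma word_ball_0: "word_ball G S 0 = {\<one>\<^bsub>G\<^esub>}"
  by (auto simp: word_ball_def)

lemma word_ball_Suc:
  "word_ball G S (Suc n) =
     insert \<one>\<^bsub>G\<^esub> {s \<otimes>\<^bsub>G\<^esub> b | s b. s \<in> S \<union> set_inv\<^bsub>G\<^esub> S \<and> b \<in> word_ball G S n}"
proof (intro equalityI subsetI)
  fix g assume "g \<in> word_ball G S (Suc n)"
  then obtain ws where ws: "set ws \<subseteq> S \<union> set_inv\<^bsub>G\<^esub> S" "length ws \<le> Suc n"
    "g = foldr (\<otimes>\<^bsub>G\<^esub>) ws \<one>\<^bsub>G\<^esub>"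
    unfolding word_ball_def by auto
  then show "g \<in> insert \<one>\<^bsub>G\<^esub> {s \<otimes>\<^bsub>G\<^esub> b | s b. s \<in> S \<union> set_inv\<^bsub>G\<^esub> S \<and> b \<in> word_ball G S n}"
    by (cases ws) (fastforce simp: word_ball_def)+
next
  fix g assume "g \<in> insert \<one>\<^bsub>G\<^esub> {s \<otimes>\<^bsub>G\<^esub> b | s b. s \<in> S \<union> set_inv\<^bsub>G\<^esub> S \<and> b \<in> word_ball G S n}"
  then consider "g = \<one>\<^bsub>G\<^esub>"
    | s ws where "s \<in> S \<union> set_inv\<^bsub>G\<^esub> S" "set ws \<subseteq> S \<union> set_inv\<^bsub>G\<^esub> S" "length ws \<le> n"
        "g = s \<otimes>\<^bsub>G\<^esub> foldr (\<otimes>\<^bsub>G\<^esub>) ws \<one>\<^bsub>G\<^esub>"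
    unfolding word_ball_def by blast
  then show "g \<in> word_ball G S (Suc n)"
  proof cases
    case 1
    then show ?thesis unfolding word_ball_def by (intro CollectI exI[of _ "[]"]) auto
  next
    case (2 s ws)
    then show ?thesis unfolding word_ball_def by (intro CollectI exI[of _ "s # ws"]) auto
  qed
qed

lemma one_in_word_ball: "\<one>\<^bsub>G\<^esub> \<in> word_ball G S n"
  by (cases n) (auto simp: word_ball_0 word_ball_Suc)

lemma word_ball_mono: "m \<le> n \<Longrightarrow> word_ball G S m \<subseteq> word_ball G S n"
  unfolding word_ball_def using order_trans by blast

section \<open>Word balls in a group\<close>

context group
begin

lemma set_inv_closed: "S \<subseteq> carrier G \<Longrightarrow> S \<union> set_inv S \<subseteq> carrier G"
  by (auto simp: SET_INV_def)

lemma word_ball_closed: "S \<subseteq> carrier G \<Longrightarrow> word_ball G S n \<subseteq> carrier G"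
proof (induction n)
  case 0
  then show ?case by (simp add: word_ball_0)
next
  case (Suc n)
  then show ?case using set_inv_closed[OF Suc.prems] by (auto simp: word_ball_Suc)
qed

lemma letter_in_word_ball:
  assumes "S \<subseteq> carrier G" "s \<in> S \<union> set_inv S"
  shows "s \<in> word_ball G S 1"
proof -
  have "s = s \<otimes> \<one>" using assms set_inv_closed by (metis r_one subsetD)
  then show ?thesis using assms(2) by (auto simp: word_ball_Suc word_ball_0)
qed

lemma word_ball_mult:
  assumes S: "S \<subseteq> carrier G" and "a \<in> word_ball G S m" and b: "b \<in> word_ball G S n"
  shows "a \<otimes> b \<in> word_ball G S (m + n)"
  using assms(2)
proof (induction m arbitrary: a)
  case 0
  have "b \<in> carrier G" using b word_ball_closed[OF S] by auto
  then show ?case using 0 b by (simp add: word_ball_0)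
next
  case (Suc m)
  from Suc.prems consider "a = \<one>"
    | s c where "s \<in> S \<union> set_inv S" "c \<in> word_ball G S m" "a = s \<otimes> c"
    by (auto simp: word_ball_Suc)
  then show ?case
  proof cases
    case 1
    moreover have "b \<in> carrier G" using b word_ball_closed[OF S] by auto
    ultimately show ?thesis
      using b word_ball_mono[of n "Suc m + n" G S] by auto
  next
    case (2 s c)
    then have "a \<otimes> b = s \<otimes> (c \<otimes> b)"
      using b word_ball_closed[OF S] set_inv_closed[OF S] m_assoc by (metis subsetD)
    then show ?thesis using 2 Suc.IH by (auto simp: word_ball_Suc)
  qed
qed

lemma word_ball_inv:
  assumes S: "S \<subseteq> carrier G" and "a \<in> word_ball G S n"
  shows "inv a \<in> word_ball G S n"
  using assms(2)
proof (induction n arbitrary: a)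
  case 0
  then show ?case by (simp add: word_ball_0)
next
  case (Suc n)
  from Suc.prems consider "a = \<one>"
    | s c where "s \<in> S \<union> set_inv S" "c \<in> word_ball G S n" "a = s \<otimes> c"
    by (auto simp: word_ball_Suc)
  then show ?case
  proof cases
    case 1
    then show ?thesis by (simp add: one_in_word_ball)
  next
    case (2 s c)
    have "s \<in> carrier G" "c \<in> carrier G"
      using 2 word_ball_closed[OF S] set_inv_closed[OF S] by auto
    then have "inv a = inv c \<otimes> inv s" using 2 by (simp add: inv_mult_group)
    moreover have "inv s \<in> S \<union> set_inv S"
      using 2(1) S by (auto simp: SET_INV_def)
    ultimately show ?thesis
      using word_ball_mult[OF S Suc.IH[OF 2(2)] letter_in_word_ball[OF S]] by simp
  qed
qed

lemma generate_subset_word_balls: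
  assumes S: "S \<subseteq> carrier G" and "g \<in> generate G S"
  shows "\<exists>n. g \<in> word_ball G S n"
  using assms(2)
proof (induction rule: generate.induct)
  case one
  then show ?case using one_in_word_ball by blast
next
  case (incl h)
  then show ?case using letter_in_word_ball[OF S] by blast
next
  case (inv h)
  then show ?case using letter_in_word_ball[OF S, of "inv h"] by (auto simp: SET_INV_def)
next
  case (eng h1 h2)
  then show ?case using word_ball_mult[OF S] by blast
qed

text \<open>
  One inclusion for all \<open>g\<close> is enough, since conjugation by \<open>g\<close> is undone by conjugation by
  the inverse of \<open>g\<close>.
\<close>

lemma conjugation_invariant_iff:
  assumes S: "S \<subseteq> carrier G"
  shows "conjugation_invariant G S \<longleftrightarrow> (\<forall>g\<in>carrier G. \<forall>s\<in>S. g \<otimes> s \<otimes> inv g \<in> S)"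
proof -
  have conj: "(g <# S) #> inv g = (\<lambda>s. g \<otimes> s \<otimes> inv g) ` S" for g
    by (auto simp: l_coset_def r_coset_def)
  have "S \<subseteq> (\<lambda>s. g \<otimes> s \<otimes> inv g) ` S"
    if closed: "\<forall>g\<in>carrier G. \<forall>s\<in>S. g \<otimes> s \<otimes> inv g \<in> S" and g: "g \<in> carrier G" for g
  proof
    fix s assume s: "s \<in> S"
    have "inv g \<otimes> s \<otimes> g \<in> S"
      using closed g s by (metis inv_closed inv_inv)
    moreover have "s = g \<otimes> (inv g \<otimes> s \<otimes> g) \<otimes> inv g"
    proof -
      have sc: "s \<in> carrier G" using s S by auto
      have "g \<otimes> (inv g \<otimes> s \<otimes> g) \<otimes> inv g = (g \<otimes> inv g) \<otimes> (s \<otimes> (g \<otimes> inv g))"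
        using g sc by (simp only: m_assoc m_closed inv_closed)
      then show ?thesis using g sc by simp
    qed
    ultimately show "s \<in> (\<lambda>s. g \<otimes> s \<otimes> inv g) ` S" by blast
  qed
  then show ?thesis unfolding conjugation_invariant_def conj by blast
qed

lemma word_ball_conj:
  assumes S: "S \<subseteq> carrier G" "conjugation_invariant G S"
    and g: "g \<in> carrier G" and "b \<in> word_ball G S n"
  shows "g \<otimes> b \<otimes> inv g \<in> word_ball G S n"
  using assms(4)
proof (induction n arbitrary: b)
  case 0
  then show ?case using g by (simp add: word_ball_0)
next
  case (Suc n)
  from Suc.prems consider "b = \<one>"
    | s c where "s \<in> S \<union> set_inv S" "c \<in> word_ball G S n" "b = s \<otimes> c"
    by (auto simp: word_ball_Suc)
  then show ?case
  proof cases
    case 1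
    then show ?thesis using g by (simp add: one_in_word_ball)
  next
    case (2 s c)
    have c: "s \<in> carrier G" "c \<in> carrier G"
      using 2 word_ball_closed[OF S(1)] set_inv_closed[OF S(1)] by auto
    have "g \<otimes> b \<otimes> inv g = (g \<otimes> s \<otimes> inv g) \<otimes> (g \<otimes> c \<otimes> inv g)"
      using 2(3) g c by (simp add: m_assoc inv_solve_left)
    moreover have "g \<otimes> s \<otimes> inv g \<in> S \<union> set_inv S"
    proof (cases "s \<in> S")
      case True
      then show ?thesis using S g conjugation_invariant_iff by blast
    next
      case False
      then obtain t where t: "t \<in> S" "s = inv t" using 2(1) by (auto simp: SET_INV_def)
      have "t \<in> carrier G" using t S by auto
      then have "g \<otimes> s \<otimes> inv g = inv (g \<otimes> t \<otimes> inv g)"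
        using t g by (simp add: inv_mult_group m_assoc)
      moreover have "g \<otimes> t \<otimes> inv g \<in> S" using t S g conjugation_invariant_iff by blast
      ultimately show ?thesis by (auto simp: SET_INV_def)
    qed
    ultimately show ?thesis using Suc.IH[OF 2(2)] by (auto simp: word_ball_Suc)
  qed
qed

lemma word_ball_subst:
  assumes S: "S \<subseteq> carrier G" and T: "T \<subseteq> word_ball G S m"
  shows "word_ball G T k \<subseteq> word_ball G S (k * m)"
proof (induction k)
  case 0
  then show ?case by (simp add: word_ball_0)
next
  case (Suc k)
  have "T \<union> set_inv T \<subseteq> word_ball G S m"
    using T word_ball_inv[OF S] by (auto simp: SET_INV_def)
  then have "s \<otimes> b \<in> word_ball G S (m + k * m)"
    if "s \<in> T \<union> set_inv T" "b \<in> word_ball G T k" for s b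
    using that Suc by (intro word_ball_mult[OF S]) auto
  then show ?case by (auto simp: word_ball_Suc one_in_word_ball)
qed

lemma word_ball_subgroup:
  assumes H: "subgroup H G" and T: "T \<subseteq> H"
  shows "word_ball (G\<lparr>carrier := H\<rparr>) T k = word_ball G T k"
proof -
  have "set_inv\<^bsub>G\<lparr>carrier := H\<rparr>\<^esub> T = set_inv T"
    unfolding SET_INV_def using T m_inv_consistent[OF H] by (intro SUP_cong) auto
  then show ?thesis by (simp add: word_ball_def)
qed

section \<open>Short generators of a subgroup\<close>

text \<open>
  A Schreier-type argument. Take a word and absorb its letters one at a time, starting from the
  right: if the part read so far is \<open>t u\<close> with \<open>t\<close> a short representative of a coset of \<open>H\<close> and
  \<open>u\<close> generated by short elements of \<open>H\<close>, and \<open>s\<close> is the next letter, then \<open>s t = t' h\<close> for a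
  short representative \<open>t'\<close>, and \<open>h = t'\<^sup>-\<^sup>1 s t\<close> is itself a short element of \<open>H\<close>.
\<close>

lemma Schreier_short_generators:
  assumes S: "generating_set G S" and H: "subgroup H G"
    and reps: "\<And>g. g \<in> carrier G \<Longrightarrow> \<exists>t\<in>word_ball G S n. inv t \<otimes> g \<in> H"
  shows "generate G (H \<inter> word_ball G S (2 * n + 1)) = H"
proof
  let ?T = "H \<inter> word_ball G S (2 * n + 1)"
  let ?K = "generate G ?T"
  interpret H: subgroup H G by (rule H)
  have Sc: "S \<subseteq> carrier G" and gen: "generate G S = carrier G"
    using S by (auto simp: generating_set_def)
  note ballc = word_ball_closed[OF Sc]
  show KH: "?K \<subseteq> H" by (rule generate_subgroup_incl[OF _ H]) simp
  have decomp: "\<exists>t\<in>word_ball G S n. \<exists>u\<in>?K. g = t \<otimes> u" if "g \<in> word_ball G S l" for g l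
    using that
  proof (induction l arbitrary: g)
    case 0
    then show ?case
      using one_in_word_ball generate.one by (intro bexI[of _ \<one>]) (auto simp: word_ball_0)
  next
    case (Suc l)
    from Suc.prems consider "g = \<one>"
      | s c where "s \<in> S \<union> set_inv S" "c \<in> word_ball G S l" "g = s \<otimes> c"
      by (auto simp: word_ball_Suc)
    then show ?case
    proof cases
      case 1
      then show ?thesis
        using one_in_word_ball generate.one by (intro bexI[of _ \<one>]) auto
    next
      case (2 s c)
      obtain t u where t: "t \<in> word_ball G S n" and u: "u \<in> ?K" and c: "c = t \<otimes> u"
        using Suc.IH[OF 2(2)] by blast
      have sc: "s \<in> carrier G" and tc: "t \<in> carrier G" and uc: "u \<in> carrier G"
        using 2(1) t u set_inv_closed[OF Sc] ballc KH H.subset by auto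
      obtain t' where t': "t' \<in> word_ball G S n" and h: "inv t' \<otimes> (s \<otimes> t) \<in> H"
        using reps[of "s \<otimes> t"] sc tc by blast
      have t'c: "t' \<in> carrier G" using t' ballc by auto
      have "inv t' \<otimes> (s \<otimes> t) \<in> word_ball G S (n + (1 + n))"
        by (intro word_ball_mult Sc word_ball_inv t t' letter_in_word_ball 2(1))
      then have "inv t' \<otimes> (s \<otimes> t) \<in> ?T" using h by (simp add: mult_2)
      then have "inv t' \<otimes> (s \<otimes> t) \<otimes> u \<in> ?K"
        using u by (metis generate.eng generate.incl)
      moreover have "g = t' \<otimes> (inv t' \<otimes> (s \<otimes> t) \<otimes> u)"
      proof -
        have "t' \<otimes> (inv t' \<otimes> (s \<otimes> t) \<otimes> u) = (t' \<otimes> inv t') \<otimes> (s \<otimes> (t \<otimes> u))"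
          using sc tc uc t'c by (simp only: m_assoc m_closed inv_closed)
        then show ?thesis using sc tc uc t'c 2(3) c by simp
      qed
      ultimately show ?thesis using t' by blast
    qed
  qed
  show "H \<subseteq> ?K"
  proof
    fix h assume h: "h \<in> H"
    then obtain l where "h \<in> word_ball G S l"
      using generate_subset_word_balls[OF Sc] gen H.subset by blast
    then obtain t u where t: "t \<in> word_ball G S n" and u: "u \<in> ?K" and htu: "h = t \<otimes> u"
      using decomp by blast
    have "t \<in> carrier G" "u \<in> carrier G" using t u ballc KH H.subset by auto
    then have "t = h \<otimes> inv u" using htu by (simp add: m_assoc)
    then have "t \<in> H" using h u KH by auto
    moreover have "t \<in> word_ball G S (2 * n + 1)"
      using t word_ball_mono[of n "2 * n + 1" G S] by auto
    ultimately show "h \<in> ?K"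
      using u htu by (auto intro: generate.eng generate.incl)
  qed
qed

end

section \<open>Passage to the quotient\<close>

lemma (in group_hom) word_ball_img:
  assumes S: "S \<subseteq> carrier G"
  shows "word_ball H (h ` S) n = h ` word_ball G S n"
proof (induction n)
  case 0
  then show ?case by (simp add: word_ball_0)
next
  case (Suc n)
  have "set_inv\<^bsub>H\<^esub> (h ` S) = h ` (set_inv\<^bsub>G\<^esub> S)"
    using S by (force simp: SET_INV_def)
  then have letters: "h ` S \<union> set_inv\<^bsub>H\<^esub> (h ` S) = h ` (S \<union> set_inv\<^bsub>G\<^esub> S)" by auto
  have mult: "h (s \<otimes>\<^bsub>G\<^esub> b) = h s \<otimes>\<^bsub>H\<^esub> h b"
    if "s \<in> S \<union> set_inv\<^bsub>G\<^esub> S" "b \<in> word_ball G S n" for s b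
    using that G.set_inv_closed[OF S] G.word_ball_closed[OF S] by (intro hom_mult) auto
  let ?L = "S \<union> set_inv\<^bsub>G\<^esub> S" and ?B = "word_ball G S n"
  have prod: "{x \<otimes>\<^bsub>H\<^esub> y | x y. x \<in> h ` ?L \<and> y \<in> h ` ?B}
      = h ` {s \<otimes>\<^bsub>G\<^esub> b | s b. s \<in> ?L \<and> b \<in> ?B}" (is "?l = ?r")
  proof
    show "?l \<subseteq> ?r"
    proof
      fix z assume "z \<in> ?l"
      then obtain s b where "s \<in> ?L" "b \<in> ?B" "z = h s \<otimes>\<^bsub>H\<^esub> h b" by blast
      then show "z \<in> ?r" using mult by (intro image_eqI[of _ _ "s \<otimes>\<^bsub>G\<^esub> b"]) auto
    qed
    show "?r \<subseteq> ?l" using mult by blast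
  qed
  show ?case unfolding word_ball_Suc letters Suc.IH prod by simp
qed

lemma (in group_hom) conjugation_invariant_img:
  assumes surj: "h ` carrier G = carrier H"
    and S: "S \<subseteq> carrier G" "conjugation_invariant G S"
  shows "conjugation_invariant H (h ` S)"
proof -
  have "h g \<otimes>\<^bsub>H\<^esub> h s \<otimes>\<^bsub>H\<^esub> inv\<^bsub>H\<^esub> h g \<in> h ` S" if "g \<in> carrier G" "s \<in> S" for g s
  proof -
    have "g \<otimes>\<^bsub>G\<^esub> s \<otimes>\<^bsub>G\<^esub> inv\<^bsub>G\<^esub> g \<in> S"
      using that S G.conjugation_invariant_iff by blast
    moreover have "h (g \<otimes>\<^bsub>G\<^esub> s \<otimes>\<^bsub>G\<^esub> inv\<^bsub>G\<^esub> g) = h g \<otimes>\<^bsub>H\<^esub> h s \<otimes>\<^bsub>H\<^esub> inv\<^bsub>H\<^esub> h g"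
      using that S(1) by (simp add: subset_iff)
    ultimately show ?thesis by (metis image_eqI)
  qed
  moreover have "h ` S \<subseteq> carrier H" using S(1) surj by auto
  ultimately show ?thesis
    using surj H.conjugation_invariant_iff[of "h ` S"] by (metis (no_types, lifting) imageE)
qed

text \<open>
  A word over the image of \<open>S\<close> lifts letter by letter, so bounded width of the quotient provides
  coset representatives of bounded length.
\<close>

lemma (in normal) short_coset_representatives:
  assumes fin: "finite_C_width (G Mod H)"
    and S: "generating_set G S" "conjugation_invariant G S"
  shows "\<exists>n. \<forall>g\<in>carrier G. \<exists>t\<in>word_ball G S n. inv t \<otimes> g \<in> H"
proof -
  let ?q = "\<lambda>a. H #> a"
  interpret q: group_hom G "G Mod H" ?q
    using is_group factorgroup_is_group r_coset_hom_Mod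
    by (simp add: group_hom_def group_hom_axioms_def)
  have Sc: "S \<subseteq> carrier G" and gen: "generate G S = carrier G"
    using S by (auto simp: generating_set_def)
  have surj: "?q ` carrier G = carrier (G Mod H)"
    unfolding carrier_FactGroup ..
  have "?q ` S \<subseteq> carrier (G Mod H)" using image_mono[OF Sc, of ?q] unfolding surj .
  moreover have "generate (G Mod H) (?q ` S) = carrier (G Mod H)"
    using q.generate_img[OF Sc] gen surj by simp
  ultimately have "generating_set (G Mod H) (?q ` S)"
    unfolding generating_set_def by simp
  then have "width (G Mod H) (?q ` S) < \<infinity>"
    using fin q.conjugation_invariant_img[OF surj Sc S(2)]
    unfolding finite_C_width_def by simp
  then obtain n where n: "carrier (G Mod H) \<subseteq> word_ball (G Mod H) (?q ` S) n"
    unfolding finite_width_iff by (elim exE)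
  have "\<exists>t\<in>word_ball G S n. inv t \<otimes> g \<in> H" if g: "g \<in> carrier G" for g
  proof -
    obtain t where t: "t \<in> word_ball G S n" "H #> g = H #> t"
    proof -
      have "H #> g \<in> carrier (G Mod H)" using g surj by (metis imageI)
      then have "H #> g \<in> ?q ` word_ball G S n"
        using n q.word_ball_img[OF Sc, of n] by (metis subsetD)
      then show ?thesis using that by (metis imageE)
    qed
    have tc: "t \<in> carrier G" using t word_ball_closed[OF Sc] by auto
    \<comment> \<open>By normality the right cosets are left cosets, so \<open>g\<close> is \<open>t\<close> times an element of \<open>H\<close>.\<close>
    have "g \<in> t <# H"
      using t(2) g tc rcos_self[OF g subgroup_axioms] coset_eq by auto
    then obtain h where "h \<in> H" "g = t \<otimes> h" by (auto simp: l_coset_def)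
    then show ?thesis using t(1) tc by (intro bexI[of _ t]) (auto simp: m_assoc[symmetric])
  qed
  then show ?thesis by blast
qed

section \<open>Extensions of groups of finite \<open>C\<close>-width\<close>

theorem proposition3p2:
  fixes G :: "('a, 'b) monoid_scheme" and H :: "'a set"
  assumes "group G"
    and "H \<lhd> G"
    and "finite_C_width (G\<lparr>carrier := H\<rparr>)"
    and "finite_C_width (G Mod H)"
  shows "finite_C_width G"
  unfolding finite_C_width_def finite_width_iff
proof (intro allI impI, elim conjE)
  fix S assume S: "generating_set G S" "conjugation_invariant G S"
  interpret normal H G by (rule assms(2))
  let ?GH = "G\<lparr>carrier := H\<rparr>"
  interpret GH: group ?GH by (rule subgroup_is_group[OF assms(1)])
  have Sc: "S \<subseteq> carrier G" using S by (auto simp: generating_set_def)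
  obtain n where n: "\<And>g. g \<in> carrier G \<Longrightarrow> \<exists>t\<in>word_ball G S n. inv\<^bsub>G\<^esub> t \<otimes>\<^bsub>G\<^esub> g \<in> H"
    using short_coset_representatives[OF assms(4) S] by blast
  define T where "T = H \<inter> word_ball G S (2 * n + 1)"
  have T: "T \<subseteq> H" by (simp add: T_def)
  have "generate G T = H"
    unfolding T_def by (rule Schreier_short_generators[OF S(1) subgroup_axioms n])
  then have "generating_set ?GH T"
    using T generate_consistent[OF T subgroup_axioms] by (simp add: generating_set_def)
  moreover have "conjugation_invariant ?GH T"
  proof -
    have "h \<otimes>\<^bsub>G\<^esub> x \<otimes>\<^bsub>G\<^esub> inv\<^bsub>G\<^esub> h \<in> T" if "h \<in> H" "x \<in> T" for h x
    proof -
      have "h \<in> carrier G" using that(1) subset by blast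
      then show ?thesis
        using that(2) word_ball_conj[OF Sc S(2)] inv_op_closed2 by (simp add: T_def)
    qed
    moreover have "inv\<^bsub>?GH\<^esub> h = inv\<^bsub>G\<^esub> h" if "h \<in> H" for h
      using that by (rule m_inv_consistent[OF subgroup_axioms])
    ultimately show ?thesis
      using T GH.conjugation_invariant_iff[of T] by simp
  qed
  ultimately have "width ?GH T < \<infinity>"
    using assms(3) unfolding finite_C_width_def by simp
  then obtain k where "carrier ?GH \<subseteq> word_ball ?GH T k"
    unfolding finite_width_iff by (elim exE)
  then have "H \<subseteq> word_ball G T k"
    by (simp add: word_ball_subgroup[OF subgroup_axioms T])
  also have "word_ball G T k \<subseteq> word_ball G S (k * (2 * n + 1))"
    by (rule word_ball_subst[OF Sc]) (simp add: T_def)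
  finally have H: "H \<subseteq> word_ball G S (k * (2 * n + 1))" .
  have "g \<in> word_ball G S (n + k * (2 * n + 1))" if g: "g \<in> carrier G" for g
  proof -
    obtain t where t: "t \<in> word_ball G S n" "inv\<^bsub>G\<^esub> t \<otimes>\<^bsub>G\<^esub> g \<in> H" using n[OF g] by blast
    have "t \<in> carrier G" using t word_ball_closed[OF Sc] by auto
    then have "g = t \<otimes>\<^bsub>G\<^esub> (inv\<^bsub>G\<^esub> t \<otimes>\<^bsub>G\<^esub> g)" using g by (simp add: m_assoc[symmetric])
    moreover have "t \<otimes>\<^bsub>G\<^esub> (inv\<^bsub>G\<^esub> t \<otimes>\<^bsub>G\<^esub> g) \<in> word_ball G S (n + k * (2 * n + 1))"
      by (intro word_ball_mult[OF Sc] t(1) subsetD[OF H t(2)])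
    ultimately show ?thesis by simp
  qed
  then show "\<exists>n. carrier G \<subseteq> word_ball G S n" by blast
qed

end
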